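(* Let $f:\mathbb{Z}^n\to\mathbb{R}\cup\{+\infty\}$ be a (globally or locally) discrete midpoint convex function with $\operatorname{arg\,min} f\ne\emptyset$, let $x^{(0)}\in\operatorname{dom} f\setminus\operatorname{arg\,min} f$ be the initial point, and let $L=\min\{\|x-x^{(0)}\|_\infty\mid x\in\operatorname{arg\,min} f\}$. Then the 2-neighborhood steepest descent algorithm finds a minimizer of $f$ in $L$ iterations.
   Context: For $x\in\mathbb{R}^n$, $\lceil x\rceil$ and $\lfloor x\rfloor$ denote the integer vectors obtained by rounding each component up, respectively down, to the nearest integer. $\operatorname{dom} f=\{x\in\mathbb{Z}^n\mid f(x)<+\infty\}$, and $\operatorname{arg\,min} f$ is the set of minimizers of $f$. A set $S\subseteq\mathbb{Z}^n$ is discrete midpoint convex if for all $x,y\in S$ with $\|x-y\|_\infty\ge2$ both $\lceil (x+y)/2\rceil$ and $\lfloor (x+y)/2\rfloor$ belong to $S$. Discrete midpoint convexity inequality for a pair $(x,y)$: $f(x)+f(y)\ge f(\lceil (x+y)/2\rceil)+f(\lfloor (x+y)/2\rfloor)$. $f$ is globally discrete midpoint convex if this inequality holds for all $x,y\in\mathbb{Z}^n$ with $\|x-y\|_\infty\ge2$. $f$ is locally discrete midpoint convex if $\operatorname{dom} f$ is a discrete midpoint convex set and the inequality holds for all $x,y\in\mathbb{Z}^n$ with $\|x-y\|_\infty=2$. For integers $k\ge2$ let $S_k(x^{(0)})=\{x\in\mathbb{Z}^n\mid\|x-x^{(0)}\|_\infty\le k\}$, and for $x\in\mathbb{Z}^n$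 let $N_2(x)=\{y\in\mathbb{Z}^n\mid\|y-x\|_\infty\le2\}$ (the 2-neighborhood of $x$). The 2-neighborhood steepest descent algorithm: D0: Find $x^{(0)}\in\operatorname{dom} f$, find $x^{(2)}$ that minimizes $f(x)$ in $S_2(x^{(0)})$, and set $k:=3$. D1: Find $x^{(k)}$ that minimizes $f(x)$ in $N_2(x^{(k-1)})\cap S_k(x^{(0)})$. D2: If $f(x^{(k)})=f(x^{(k-1)})$, then output $x^{(k-1)}$ and stop. D3: Set $k:=k+1$, and go to D1. *)

theory Defs
  imports "HOL-Analysis.Analysis"
begin

text \<open>Functions from the integer lattice to the reals with plus infinity are modelled as
  functions \<open>f :: int^'n \<Rightarrow> ereal\<close> that never take the value \<open>-\<infinity>\<close>; the latter is stated as a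
  hypothesis where it is needed.\<close>

definition linf_norm :: "int^'n \<Rightarrow> nat" where
  "linf_norm x = Max (range (\<lambda>i. nat \<bar>x $ i\<bar>))"

definition real_vec :: "int^'n \<Rightarrow> real^'n" where
  "real_vec x = (\<chi> i. real_of_int (x $ i))"

definition vec_ceiling :: "real^'n \<Rightarrow> int^'n" where
  "vec_ceiling x = (\<chi> i. \<lceil>x $ i\<rceil>)"

definition vec_floor :: "real^'n \<Rightarrow> int^'n" where
  "vec_floor x = (\<chi> i. \<lfloor>x $ i\<rfloor>)"

definition mid_up :: "int^'n \<Rightarrow> int^'n \<Rightarrow> int^'n" where
  "mid_up x y = vec_ceiling (midpoint (real_vec x) (real_vec y))"

definition mid_down :: "int^'n \<Rightarrow> int^'n \<Rightarrow> int^'n" where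
  "mid_down x y = vec_floor (midpoint (real_vec x) (real_vec y))"

definition eff_dom :: "(int^'n \<Rightarrow> ereal) \<Rightarrow> (int^'n) set" where
  "eff_dom f = {x. f x < \<infinity>}"

definition minimizes_on :: "(int^'n \<Rightarrow> ereal) \<Rightarrow> (int^'n) set \<Rightarrow> int^'n \<Rightarrow> bool" where
  "minimizes_on f S x \<longleftrightarrow> is_arg_min f (\<lambda>y. y \<in> S) x"

definition argmin_set :: "(int^'n \<Rightarrow> ereal) \<Rightarrow> (int^'n) set" where
  "argmin_set f = {x. minimizes_on f UNIV x}"

definition dmc_set :: "(int^'n) set \<Rightarrow> bool" where
  "dmc_set S \<longleftrightarrow>
     (\<forall>x\<in>S. \<forall>y\<in>S. linf_norm (x - y) \<ge> 2 \<longrightarrow> mid_up x y \<in> S \<and> mid_down x y \<in> S)"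

definition dmc_ineq :: "(int^'n \<Rightarrow> ereal) \<Rightarrow> int^'n \<Rightarrow> int^'n \<Rightarrow> bool" where
  "dmc_ineq f x y \<longleftrightarrow> f x + f y \<ge> f (mid_up x y) + f (mid_down x y)"

definition globally_dmc :: "(int^'n \<Rightarrow> ereal) \<Rightarrow> bool" where
  "globally_dmc f \<longleftrightarrow> (\<forall>x y. linf_norm (x - y) \<ge> 2 \<longrightarrow> dmc_ineq f x y)"

definition locally_dmc :: "(int^'n \<Rightarrow> ereal) \<Rightarrow> bool" where
  "locally_dmc f \<longleftrightarrow>
     dmc_set (eff_dom f) \<and> (\<forall>x y. linf_norm (x - y) = 2 \<longrightarrow> dmc_ineq f x y)"

definition sbox :: "nat \<Rightarrow> int^'n \<Rightarrow> (int^'n) set" where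
  "sbox k x0 = {x. linf_norm (x - x0) \<le> k}"

definition nbhd2 :: "int^'n \<Rightarrow> (int^'n) set" where
  "nbhd2 x = {y. linf_norm (y - x) \<le> 2}"

text \<open>The 2-neighborhood steepest descent algorithm:
  \<^item> D0: find \<open>x0\<close> in the effective domain, find \<open>x\<close> minimizing \<open>f\<close> on \<open>sbox 2 x0\<close>, set \<open>k = 3\<close>.
  \<^item> D1: find \<open>y\<close> minimizing \<open>f\<close> on \<open>nbhd2 x \<inter> sbox k x0\<close>.
  \<^item> D2: if \<open>f y = f x\<close>, output \<open>x\<close> and stop.
  \<^item> D3: replace \<open>x\<close> by \<open>y\<close>, increment \<open>k\<close>, go to D1.

  It is a nondeterministic transition system, since the minimizers need not be unique. The state
  \<open>Loop k x\<close> means that D1 is about to be executed with counter \<open>k\<close> and current point \<open>x\<close>.\<close>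

datatype 'n sd_state = Loop nat "int^'n" | Output "int^'n"

inductive sd_start :: "(int^'n \<Rightarrow> ereal) \<Rightarrow> int^'n \<Rightarrow> 'n sd_state \<Rightarrow> bool"
  for f x0 where
  D0: "x0 \<in> eff_dom f \<Longrightarrow> minimizes_on f (sbox 2 x0) x \<Longrightarrow> sd_start f x0 (Loop 3 x)"

text \<open>One transition is one iteration, that is, one pass through D1--D3.\<close>

inductive sd_iter :: "(int^'n \<Rightarrow> ereal) \<Rightarrow> int^'n \<Rightarrow> 'n sd_state \<Rightarrow> 'n sd_state \<Rightarrow> bool"
  for f x0 where
  D2: "minimizes_on f (nbhd2 x \<inter> sbox k x0) y \<Longrightarrow> f y = f x \<Longrightarrow>
         sd_iter f x0 (Loop k x) (Output x)"
| D3: "minimizes_on f (nbhd2 x \<inter> sbox k x0) y \<Longrightarrow> f y \<noteq> f x \<Longrightarrow>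
         sd_iter f x0 (Loop k x) (Loop (Suc k) y)"

text \<open>Total correctness for all choices of minimizers: the algorithm can be started, no
  execution gets stuck, and every execution stops after exactly \<open>T\<close> iterations with an output
  in \<open>Z\<close>.\<close>

definition sd_outputs_after ::
  "(int^'n \<Rightarrow> ereal) \<Rightarrow> int^'n \<Rightarrow> nat \<Rightarrow> (int^'n) set \<Rightarrow> bool" where
  "sd_outputs_after f x0 T Z \<longleftrightarrow>
     (\<exists>s. sd_start f x0 s) \<and>
     (\<forall>s m t. sd_start f x0 s \<and> (sd_iter f x0 ^^ m) s t \<longrightarrow>
        m \<le> T \<and>
        (m < T \<longrightarrow> (\<exists>t'. sd_iter f x0 t t')) \<and>
        (m = T \<longrightarrow> (\<exists>z\<in>Z. t = Output z)))"

definition min_dist :: "(int^'n \<Rightarrow> ereal) \<Rightarrow> int^'n \<Rightarrow> nat" where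
  "min_dist f x0 = (LEAST l. \<exists>x\<in>argmin_set f. l = linf_norm (x - x0))"

end

theory Submission
  imports Defs
begin

text \<open>
  Write \<open>S\<^sub>k\<close> for the box of radius \<open>k\<close> around the starting point. After the step with counter
  \<open>k\<close> the current point minimizes \<open>f\<close> on all of \<open>S\<^sub>k\<close>, although that step searched only a
  neighbourhood of radius 2, and two consecutive boxes have the same minimum only when that minimum
  is global. Hence the values decrease strictly until the box of radius \<open>L\<close>, the first to contain
  a global minimizer, and the following pass stops.

  Both facts come from a parallelogram inequality. For \<open>x\<close> and \<open>y\<close> at distance \<open>m\<close>, split
  \<open>y - x\<close> into \<open>m\<close> vectors \<open>d\<^sub>1, \<dots>, d\<^sub>m\<close> with entries in \<open>{-1, 0, 1}\<close>, where \<open>d\<^sub>j\<close> has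
  entry \<open>1\<close> where \<open>y\<close> exceeds \<open>x\<close> by at least \<open>j\<close>, and \<open>-1\<close> where \<open>x\<close> exceeds \<open>y\<close> by at least
  \<open>m + 1 - j\<close>. The sums over any index set \<open>K\<close> and over its complement then satisfy
  \<open>f (x + d\<^sub>K) + f (y - d\<^sub>K) \<le> f x + f y\<close> (\<open>parallelogram_inequality\<close>). For two indices
  this is precisely discrete midpoint convexity at distance 2, because the positive parts decrease
  with \<open>j\<close> and the negative parts increase; the general case is a sum of such unit
  parallelograms. The sum makes sense only if all their vertices have finite values. This is the
  purely combinatorial part: a discrete midpoint convex set that contains \<open>x\<close> and \<open>y\<close> contains
  all \<open>x + d\<^sub>K\<close> (\<open>move_in_dmc_set\<close>).

  With \<open>K = {1, m}\<close> the point \<open>x + d\<^sub>K\<close> is within distance 2 of \<open>x\<close>. If \<open>x\<close> minimizes \<open>f\<close> on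
  \<open>S\<^sub>k\<close> and \<open>y\<close> lies in the next box, then \<open>y - d\<^sub>K\<close> is back in \<open>S\<^sub>k\<close>, since it moved at
  least one unit towards \<open>x\<close> in every coordinate where the two differ. So \<open>f x \<le> f (y - d\<^sub>K)\<close>, and
  the inequality leaves \<open>f (x + d\<^sub>K) \<le> f y\<close> (\<open>minimizer_of_next_box_nearby\<close>). If moreover \<open>x\<close>
  already lies in \<open>S\<^bsub>k-1\<^esub>\<close>, a better point of \<open>S\<^bsub>k+1\<^esub>\<close> can thus be chosen at distance exactly 2,
  and its two midpoints with \<open>x\<close> lie in \<open>S\<^sub>k\<close>, contradicting convexity
  (\<open>stationary_minimizes_larger_box\<close>).
\<close>

section \<open>Norm and midpoints in coordinates\<close>

lemma linf_norm_le_iff: "linf_norm (x :: int^'n) \<le> k \<longleftrightarrow> (\<forall>i. \<bar>x $ i\<bar> \<le> int k)"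
  unfolding linf_norm_def by (subst Max_le_iff) (auto simp: nat_le_iff)

lemma linf_norm_ge2I: "2 \<le> \<bar>(x :: int^'n) $ i\<bar> \<Longrightarrow> 2 \<le> linf_norm x"
  using linf_norm_le_iff[of x 1] by (cases "linf_norm x \<le> 1") (auto dest!: spec[of _ i])

lemma linf_norm_minus_commute: "linf_norm (x - y) = linf_norm (y - x :: int^'n)"
  unfolding linf_norm_def by (simp add: abs_minus_commute)

lemma linf_norm_attained: "\<exists>i. \<bar>(x :: int^'n) $ i\<bar> = int (linf_norm x)"
proof -
  have "linf_norm x \<in> range (\<lambda>i. nat \<bar>x $ i\<bar>)"
    unfolding linf_norm_def by (rule Max_in) auto
  then show ?thesis by auto
qed

lemma sbox_iff: "x \<in> sbox k x0 \<longleftrightarrow> (\<forall>i. \<bar>x $ i - x0 $ i\<bar> \<le> int k)"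
  by (simp add: sbox_def linf_norm_le_iff)

lemma nbhd2_iff: "y \<in> nbhd2 x \<longleftrightarrow> (\<forall>i. \<bar>y $ i - x $ i\<bar> \<le> 2)"
  using linf_norm_le_iff[of "y - x" 2] by (simp add: nbhd2_def)

lemma mid_down_nth: "mid_down x y $ i = (x $ i + y $ i) div 2"
proof -
  have "mid_down x y $ i = \<lfloor>(real_of_int (x $ i) + real_of_int (y $ i)) / real_of_int 2\<rfloor>"
    by (simp add: mid_down_def vec_floor_def real_vec_def midpoint_def field_simps)
  also have "\<dots> = (x $ i + y $ i) div 2"
    using floor_divide_of_int_eq[of "x $ i + y $ i" 2] by simp
  finally show ?thesis .
qed

lemma mid_up_nth: "mid_up x y $ i = (x $ i + y $ i + 1) div 2"
proof -
  have "mid_up x y $ i = \<lceil>(real_of_int (x $ i) + real_of_int (y $ i)) / real_of_int 2\<rceil>"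
    by (simp add: mid_up_def vec_ceiling_def real_vec_def midpoint_def field_simps)
  also have "\<dots> = - ((- (x $ i + y $ i)) div 2)"
    using ceiling_divide_eq_div[of "x $ i + y $ i" 2] by simp
  also have "\<dots> = (x $ i + y $ i + 1) div 2" by presburger
  finally show ?thesis .
qed

lemma dmc_setD:
  assumes "dmc_set S" "x \<in> S" "y \<in> S" "2 \<le> \<bar>y $ i - x $ i\<bar>"
  shows "mid_up x y \<in> S" "mid_down x y \<in> S"
proof -
  have "2 \<le> linf_norm (x - y)"
    using assms(4) by (intro linf_norm_ge2I[of _ i]) (simp add: abs_minus_commute)
  then show "mid_up x y \<in> S" "mid_down x y \<in> S"
    using assms(1-3) unfolding dmc_set_def by blast+
qed

section \<open>Halving in a discrete midpoint convex set\<close>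

text \<open>Moving \<open>z\<close> to its lower midpoint with \<open>y\<close> halves the remaining difference, rounding
  positive entries up and the absolute values of negative entries down. Hence no positive entry
  ever vanishes, while the negative ones stay strictly smaller in absolute value than the largest
  entry. When the largest entry has come down to \<open>1\<close>, the negative ones are gone and the
  difference is the indicator of the coordinates in which the original \<open>z\<close> was below \<open>y\<close>.\<close>

lemma decrement_in_dmc_set_strict:
  assumes "dmc_set S" "z \<in> S" "y \<in> S"
    and "y $ i0 - z $ i0 = int m" "m \<ge> 1"
    and "\<And>i. - int m < y $ i - z $ i" "\<And>i. y $ i - z $ i \<le> int m"
  shows "y - (\<chi> i. of_bool (z $ i < y $ i)) \<in> S"
  using assms
proof (induction m arbitrary: z rule: less_induct)
  case (less m)
  show ?case
  proof (cases "m = 1")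
    case True
    have "y - (\<chi> i. of_bool (z $ i < y $ i)) = z"
      unfolding vec_eq_iff
    proof
      fix i
      show "(y - (\<chi> i. of_bool (z $ i < y $ i))) $ i = z $ i"
        using less.prems(6,7)[of i] True by (cases "z $ i < y $ i") auto
    qed
    then show ?thesis using less.prems by simp
  next
    case False
    then have m2: "m \<ge> 2" using less.prems by simp
    let ?z = "mid_down z y" and ?m = "(m + 1) div 2"
    have z: "?z \<in> S"
      using less.prems m2 by (intro dmc_setD(2)[of S z y i0]) auto
    have m: "int ?m = (int m + 1) div 2" by simp
    have "y - (\<chi> i. of_bool (?z $ i < y $ i)) \<in> S"
    proof (rule less.IH)
      show "?m < m" "1 \<le> ?m" using m2 by auto
      show "dmc_set S" "?z \<in> S" "y \<in> S" using less.prems z by auto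
      show "y $ i0 - ?z $ i0 = int ?m"
        using less.prems(4) unfolding m mid_down_nth by presburger
      fix i
      show "- int ?m < y $ i - ?z $ i"
        using less.prems(6)[of i] unfolding m mid_down_nth by presburger
      show "y $ i - ?z $ i \<le> int ?m"
        using less.prems(7)[of i] unfolding m mid_down_nth by presburger
    qed
    moreover have "?z $ i < y $ i \<longleftrightarrow> z $ i < y $ i" for i
      unfolding mid_down_nth by presburger
    ultimately show ?thesis by simp
  qed
qed

text \<open>The midpoints round positive and negative entries of \<open>y - x\<close> in opposite ways; at odd
  distance a point is needed where both are rounded towards zero. One takes the upper midpoint of
  \<open>x\<close> with \<open>y\<close> lowered by one unit wherever it exceeds \<open>x\<close>. The lowered point is supplied by
  \<open>decrement_in_dmc_set_strict\<close> after one midpoint step, which makes the largest entry strictly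
  dominant because \<open>m\<close> is odd.\<close>

lemma trunc_half_in_dmc_set:
  assumes "dmc_set S" "x \<in> S" "y \<in> S"
    and "y $ i0 - x $ i0 = int m" "odd m" "m \<ge> 3"
    and "\<And>i. \<bar>y $ i - x $ i\<bar> \<le> int m"
  shows "x + (\<chi> i. sgn (y $ i - x $ i) * (\<bar>y $ i - x $ i\<bar> div 2)) \<in> S"
proof -
  let ?z = "mid_down x y" and ?m = "(m + 1) div 2"
  let ?p = "y - (\<chi> i. of_bool (x $ i < y $ i))"
  have m: "int ?m = (int m + 1) div 2" by simp
  have odd: "odd (int m)" using assms by simp
  have z: "?z \<in> S"
    using assms by (intro dmc_setD(2)[of S x y i0]) auto
  have "y - (\<chi> i. of_bool (?z $ i < y $ i)) \<in> S"
  proof (rule decrement_in_dmc_set_strict)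
    show "1 \<le> ?m" using assms by auto
    show "dmc_set S" "?z \<in> S" "y \<in> S" using assms z by auto
    show "y $ i0 - ?z $ i0 = int ?m"
      using assms(4) unfolding m mid_down_nth by presburger
    fix i
    show "- int ?m < y $ i - ?z $ i"
      using assms(7)[of i] odd unfolding m mid_down_nth by presburger
    show "y $ i - ?z $ i \<le> int ?m"
      using assms(7)[of i] unfolding m mid_down_nth by presburger
  qed
  moreover have "?z $ i < y $ i \<longleftrightarrow> x $ i < y $ i" for i
    unfolding mid_down_nth by presburger
  ultimately have "?p \<in> S" by simp
  then have "mid_up x ?p \<in> S"
    using assms by (intro dmc_setD(1)[of S x ?p i0]) auto
  moreover have "mid_up x ?p = x + (\<chi> i. sgn (y $ i - x $ i) * (\<bar>y $ i - x $ i\<bar> div 2))"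
  proof -
    have "(a + (b - of_bool (a < b)) + 1) div 2 = a + sgn (b - a) * (\<bar>b - a\<bar> div 2)" for a b :: int
    proof (cases a b rule: linorder_cases)
      case less
      have "(a + b) div 2 = a + (b - a) div 2" by presburger
      with less show ?thesis by simp
    next
      case greater
      have "(a + b + 1) div 2 = a - (a - b) div 2" by presburger
      with greater show ?thesis by simp
    qed simp
    then show ?thesis by (simp add: vec_eq_iff mid_up_nth)
  qed
  ultimately show ?thesis by simp
qed

section \<open>Layered directions\<close>

text \<open>In what follows, \<open>A j\<close> and \<open>B j\<close> are the sets of coordinates in which the unit vector \<open>d\<^sub>j\<close>
  has entry \<open>1\<close> and \<open>-1\<close>. The index set is an arbitrary finite set of naturals rather than an initial
  segment, so that a subset of a decomposition is again a decomposition without renumbering.\<close>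

definition move :: "(nat \<Rightarrow> 'n set) \<Rightarrow> (nat \<Rightarrow> 'n set) \<Rightarrow> nat set \<Rightarrow> int^'n" where
  "move A B K = (\<Sum>j\<in>K. \<chi> i. of_bool (i \<in> A j) - of_bool (i \<in> B j))"

text \<open>The last clause makes some coordinate move in the same direction in every step, so that a
  sum of \<open>m\<close> steps has length exactly \<open>m\<close>: nonempty decreasing sets \<open>A j\<close> all share the elements
  of the last one, nonempty increasing sets \<open>B j\<close> those of the first.\<close>

definition layered :: "(nat \<Rightarrow> 'n set) \<Rightarrow> (nat \<Rightarrow> 'n set) \<Rightarrow> nat set \<Rightarrow> bool" where
  "layered A B J \<longleftrightarrow> finite J \<and>
     (\<forall>j\<in>J. \<forall>k\<in>J. j \<le> k \<longrightarrow> A k \<subseteq> A j \<and> B j \<subseteq> B k) \<and>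
     (\<forall>j\<in>J. \<forall>k\<in>J. A j \<inter> B k = {}) \<and>
     ((\<forall>j\<in>J. A j \<noteq> {}) \<or> (\<forall>j\<in>J. B j \<noteq> {}))"

lemma layered_subset: "layered A B J \<Longrightarrow> K \<subseteq> J \<Longrightarrow> layered A B K"
  unfolding layered_def by (meson finite_subset subset_iff)

lemma layeredD:
  assumes "layered A B J"
  shows "finite J"
    and "j \<in> J \<Longrightarrow> k \<in> J \<Longrightarrow> j \<le> k \<Longrightarrow> i \<in> A k \<Longrightarrow> i \<in> A j"
    and "j \<in> J \<Longrightarrow> k \<in> J \<Longrightarrow> j \<le> k \<Longrightarrow> i \<in> B j \<Longrightarrow> i \<in> B k"
    and "j \<in> J \<Longrightarrow> k \<in> J \<Longrightarrow> i \<in> A j \<Longrightarrow> i \<notin> B k"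
  using assms unfolding layered_def by blast+

lemma move_empty [simp]: "move A B {} = 0"
  by (simp add: move_def)

lemma move_insert: "finite K \<Longrightarrow> j \<notin> K \<Longrightarrow> move A B (insert j K) = move A B {j} + move A B K"
  unfolding move_def by simp

lemma move_Diff: "finite J \<Longrightarrow> K \<subseteq> J \<Longrightarrow> move A B (J - K) = move A B J - move A B K"
  unfolding move_def by (rule sum_diff)

lemma move_nth:
  "finite K \<Longrightarrow> move A B K $ i = int (card {j\<in>K. i \<in> A j}) - int (card {j\<in>K. i \<in> B j})"
  by (simp add: move_def sum_subtractf of_bool_def sum.If_cases Int_def)

lemma move_bound:
  assumes "layered A B J"
  shows "\<bar>move A B J $ i\<bar> \<le> int (card J)"
proof -
  have fin: "finite J" using layeredD(1) assms by blast
  have "card {j\<in>J. i \<in> A j} \<le> card J" "card {j\<in>J. i \<in> B j} \<le> card J"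
    using fin by (auto intro: card_mono)
  then show ?thesis using fin by (simp add: move_nth)
qed

lemma move_extreme:
  assumes "layered A B J" "J \<noteq> {}"
  shows "\<exists>i. \<bar>move A B J $ i\<bar> = int (card J)"
proof -
  have fin: "finite J" using layeredD(1) assms by blast
  have "Max J \<in> J" "Min J \<in> J" using fin assms by auto
  from assms(1) consider "\<forall>j\<in>J. A j \<noteq> {}" | "\<forall>j\<in>J. B j \<noteq> {}"
    unfolding layered_def by blast
  then show ?thesis
  proof cases
    case 1
    then obtain i where i: "i \<in> A (Max J)" using \<open>Max J \<in> J\<close> by blast
    have "{j\<in>J. i \<in> A j} = J"
      using i fin by (auto intro: layeredD(2)[OF assms(1) _ \<open>Max J \<in> J\<close>])
    moreover have "{j\<in>J. i \<in> B j} = {}"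
      using i by (auto dest: layeredD(4)[OF assms(1) \<open>Max J \<in> J\<close>])
    ultimately have "\<bar>move A B J $ i\<bar> = int (card J)"
      unfolding move_nth[OF fin] by (simp only: card.empty)
    then show ?thesis ..
  next
    case 2
    then obtain i where i: "i \<in> B (Min J)" using \<open>Min J \<in> J\<close> by blast
    have "{j\<in>J. i \<in> B j} = J"
      using i fin by (auto intro: layeredD(3)[OF assms(1) \<open>Min J \<in> J\<close>])
    moreover have "{j\<in>J. i \<in> A j} = {}"
      using i by (auto dest: layeredD(4)[OF assms(1) _ \<open>Min J \<in> J\<close>])
    ultimately have "\<bar>move A B J $ i\<bar> = int (card J)"
      unfolding move_nth[OF fin] by (simp only: card.empty)
    then show ?thesis ..
  qed
qed

text \<open>The elements of even rank. The indices \<open>j\<close> with \<open>i \<in> A j\<close> form an initial segment of \<open>J\<close>,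
  and the indices with \<open>i \<in> B j\<close> the complement of one, so this subset splits the movement of all
  coordinates into halves at once.\<close>

lemma every_second_element:
  fixes J :: "nat set"
  assumes "finite J"
  shows "\<exists>E\<subseteq>J. \<forall>L\<subseteq>J. (\<forall>k\<in>L. \<forall>j\<in>J. j \<le> k \<longrightarrow> j \<in> L) \<longrightarrow> card (E \<inter> L) = card L div 2"
  using assms
proof (induction J rule: finite_linorder_max_induct)
  case empty
  then show ?case by auto
next
  case (insert b J)
  then obtain E where E: "E \<subseteq> J"
    and half: "\<And>L. L \<subseteq> J \<Longrightarrow> (\<forall>k\<in>L. \<forall>j\<in>J. j \<le> k \<longrightarrow> j \<in> L) \<Longrightarrow> card (E \<inter> L) = card L div 2"
    by meson
  have b: "b \<notin> J" using insert by auto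
  define E' where "E' = (if odd (card J) then insert b E else E)"
  have "card (E' \<inter> L) = card L div 2"
    if L: "L \<subseteq> insert b J" "\<forall>k\<in>L. \<forall>j\<in>insert b J. j \<le> k \<longrightarrow> j \<in> L" for L
  proof (cases "b \<in> L")
    case True
    then have L': "L = insert b J" using L insert.hyps by force
    have "card E = card J div 2" using half[of J] E by (simp add: Int_absorb2)
    moreover have "finite E" "b \<notin> E" using E b insert.hyps finite_subset by auto
    moreover have "E' \<inter> L = E'" using E L' by (auto simp: E'_def)
    ultimately show ?thesis using b insert.hyps L' by (auto simp: E'_def elim!: oddE evenE)
  next
    case False
    then have "E' \<inter> L = E \<inter> L" by (auto simp: E'_def)
    then show ?thesis using half[of L] L False by auto
  qed
  moreover have "E' \<subseteq> insert b J" using E by (auto simp: E'_def)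
  ultimately show ?case by blast
qed

text \<open>The complement of an initial segment contains a rounded half of its size in elements of even
  rank, and the direction of rounding depends on the parity of \<open>card J\<close>. Negative entries are
  therefore rounded down for even size, which gives the lower midpoint, and towards zero for odd
  size, which gives the point of \<open>trunc_half_in_dmc_set\<close>.\<close>

lemma half_move:
  assumes lay: "layered A B J"
  obtains E where "E \<subseteq> J" "card E = card J div 2"
    and "even (card J) \<Longrightarrow> move A B E = (\<chi> i. move A B J $ i div 2)"
    and "odd (card J) \<Longrightarrow> move A B E = (\<chi> i. sgn (move A B J $ i) * (\<bar>move A B J $ i\<bar> div 2))"
proof -
  have fin: "finite J" using layeredD(1)[OF lay] .
  obtain E where E: "E \<subseteq> J"
    and half: "\<And>L. L \<subseteq> J \<Longrightarrow> (\<forall>k\<in>L. \<forall>j\<in>J. j \<le> k \<longrightarrow> j \<in> L) \<Longrightarrow> card (E \<inter> L) = card L div 2"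
    using every_second_element[OF fin] by meson
  have finE: "finite E" using E fin finite_subset by auto
  have cE: "card E = card J div 2" using half[of J] E by (simp add: Int_absorb2)
  have coord: "move A B E $ i = (if even (card J) then w div 2 else sgn w * (\<bar>w\<bar> div 2))"
    if w: "w = move A B J $ i" for i w
  proof (cases "\<exists>j\<in>J. i \<in> A j")
    case True
    define L where "L = {j\<in>J. i \<in> A j}"
    have noB: "{j\<in>J. i \<in> B j} = {}" "{j\<in>E. i \<in> B j} = {}"
      using True lay E unfolding layered_def by blast+
    have "card (E \<inter> L) = card L div 2"
      using lay by (intro half) (auto simp: L_def layered_def)
    moreover have "{j\<in>E. i \<in> A j} = E \<inter> L" using E by (auto simp: L_def)
    ultimately have "move A B E $ i = int (card L) div 2"
      unfolding move_nth[OF finE] noB by simp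
    moreover have "w = int (card L)" unfolding w move_nth[OF fin] noB by (simp add: L_def)
    ultimately show ?thesis by (auto simp: sgn_if)
  next
    case False
    define U where "U = {j\<in>J. i \<in> B j}"
    have noA: "{j\<in>J. i \<in> A j} = {}" "{j\<in>E. i \<in> A j} = {}" using False E by auto
    have U: "U \<subseteq> J" by (auto simp: U_def)
    have "card (E \<inter> (J - U)) = card (J - U) div 2"
      using lay by (intro half) (auto simp: U_def layered_def)
    moreover have "card E = card (E \<inter> U) + card (E \<inter> (J - U))"
    proof -
      have "E = (E \<inter> U) \<union> (E \<inter> (J - U))" using E by blast
      then show ?thesis using finE by (metis (no_types, lifting) Diff_disjoint Int_assoc
        Int_commute Int_empty_right card_Un_disjoint finite_Int inf_left_commute)
    qed
    ultimately have cEU: "card (E \<inter> U) = card J div 2 - card (J - U) div 2" using cE by linarith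
    have cJ: "card J = card U + card (J - U)"
      using U fin by (metis Diff_disjoint Un_Diff_cancel Un_absorb1 card_Un_disjoint finite_Diff finite_subset)
    have "card (E \<inter> U) = (if even (card J) then (card U + 1) div 2 else card U div 2)"
      unfolding cEU unfolding cJ
      by (cases "even (card U)"; cases "even (card (J - U))") (auto elim!: evenE oddE)
    moreover have "{j\<in>E. i \<in> B j} = E \<inter> U" using E by (auto simp: U_def)
    ultimately have m: "move A B E $ i
        = - (if even (card J) then (int (card U) + 1) div 2 else int (card U) div 2)"
      unfolding move_nth[OF finE] noA by (simp add: zdiv_int add.commute)
    have wU: "w = - int (card U)" unfolding w move_nth[OF fin] noA by (simp add: U_def)
    have "- int (card U) div 2 = - ((int (card U) + 1) div 2)" by presburger
    then show ?thesis unfolding m wU by (simp add: sgn_if)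
  qed
  show thesis
    using that[OF E cE] coord by (auto simp: vec_eq_iff)
qed

text \<open>For even size the two midpoints are the partial sums over the elements of even and of odd
  rank. For odd size one of these two sums is obtained by truncation from whichever endpoint
  sees the extremal coordinate as positive.\<close>

lemma proper_move_in_dmc_set:
  assumes S: "dmc_set S" and lay: "layered A B J" and x: "x \<in> S" "x + move A B J \<in> S"
    and card: "card J \<ge> 2"
  obtains M where "M \<subseteq> J" "M \<noteq> {}" "M \<noteq> J" "x + move A B M \<in> S"
    "even (card J) \<Longrightarrow> x + move A B (J - M) \<in> S"
proof -
  let ?y = "x + move A B J"
  have fin: "finite J" and ne: "J \<noteq> {}" using card by (auto intro: card_ge_0_finite)
  obtain i0 where i0: "\<bar>move A B J $ i0\<bar> = int (card J)" using move_extreme[OF lay ne] by blast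
  obtain E where E: "E \<subseteq> J" and cE: "card E = card J div 2"
    and ev: "even (card J) \<Longrightarrow> move A B E = (\<chi> i. move A B J $ i div 2)"
    and od: "odd (card J) \<Longrightarrow> move A B E = (\<chi> i. sgn (move A B J $ i) * (\<bar>move A B J $ i\<bar> div 2))"
    using half_move[OF lay] by metis
  have proper: "E \<noteq> {}" "E \<noteq> J" using cE card by auto
  then have proper': "J - E \<noteq> {}" "J - E \<noteq> J" using E by auto
  have diff: "move A B (J - E) = move A B J - move A B E" using move_Diff fin E by blast
  show thesis
  proof (cases "even (card J)")
    case True
    have "x + move A B E = mid_down x ?y"
      unfolding ev[OF True] by (simp add: vec_eq_iff mid_down_nth)
    moreover have "x + move A B (J - E) = mid_up x ?y"
      unfolding diff ev[OF True] by (auto simp: vec_eq_iff mid_up_nth)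
    ultimately show thesis
      using that[of E] E proper dmc_setD[OF S x, of i0] i0 card by auto
  next
    case False
    then have c3: "card J \<ge> 3" using card by (cases "card J = 2") auto
    consider "move A B J $ i0 = int (card J)" | "move A B J $ i0 = - int (card J)"
      using i0 by linarith
    then show thesis
    proof cases
      case 1
      have "x + (\<chi> i. sgn (?y $ i - x $ i) * (\<bar>?y $ i - x $ i\<bar> div 2)) \<in> S"
        using 1 False c3 move_bound[OF lay]
        by (intro trunc_half_in_dmc_set[OF S x, of i0 "card J"]) auto
      then have "x + move A B E \<in> S" unfolding od[OF False] by simp
      then show thesis using that[of E] E proper False by auto
    next
      case 2
      have mem: "?y + (\<chi> i. sgn (x $ i - ?y $ i) * (\<bar>x $ i - ?y $ i\<bar> div 2)) \<in> S"
        using 2 False c3 move_bound[OF lay]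
        by (intro trunc_half_in_dmc_set[OF S x(2,1), of i0 "card J"]) auto
      have eq: "?y + (\<chi> i. sgn (x $ i - ?y $ i) * (\<bar>x $ i - ?y $ i\<bar> div 2))
          = x + move A B (J - E)"
        unfolding diff od[OF False] by (simp add: vec_eq_iff sgn_minus)
      have "x + move A B (J - E) \<in> S" using mem unfolding eq .
      then show thesis using that[of "J - E"] proper' False by auto
    qed
  qed
qed

text \<open>Once one proper partial sum \<open>M\<close> is in \<open>S\<close>, the induction hypothesis applies between any two
  partial sums other than the full pair. It gives all singletons inside \<open>M\<close>, from a singleton every
  larger index set, and through two-element sets all remaining singletons, provided that a
  two-element set is still proper. In the exceptional case of two indices the complement of \<open>M\<close> is
  the other singleton.\<close>

lemma move_in_dmc_set:
  assumes "dmc_set S" "layered A B J" "x \<in> S" "x + move A B J \<in> S" "K \<subseteq> J"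
  shows "x + move A B K \<in> S"
  using assms
proof (induction "card J" arbitrary: J x K rule: less_induct)
  case less
  have fin: "finite J" using layeredD(1)[OF less.prems(2)] .
  show ?case
  proof (cases "card J \<ge> 2 \<and> K \<noteq> {}")
    case False
    have "K = J" if "K \<noteq> {}"
    proof (rule card_seteq[OF fin less.prems(5)])
      have "card K > 0" using that finite_subset[OF less.prems(5) fin] by (simp add: card_gt_0_iff)
      then show "card J \<le> card K" using False that by auto
    qed
    then show ?thesis using less.prems by (cases "K = {}") auto
  next
    case True
    have IH: "z + move A B K' \<in> S"
      if "z \<in> S" "z + move A B J' \<in> S" "J' \<subset> J" "K' \<subseteq> J'" for z J' K'
      using less.hyps[of J' z K'] psubset_card_mono[OF fin, of J'] that less.prems(1)
        layered_subset[OF less.prems(2), of J'] by blast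
    have from_singleton: "x + move A B K' \<in> S"
      if "j \<in> K'" "K' \<subseteq> J" "x + move A B {j} \<in> S" for j K'
    proof -
      have split: "x + move A B K'' = (x + move A B {j}) + move A B (K'' - {j})"
        if "j \<in> K''" "K'' \<subseteq> J" for K''
        using move_insert[of "K'' - {j}" j A B] that finite_subset[OF _ fin]
        by (simp add: insert_absorb)
      have "j \<in> J" using that by blast
      have "(x + move A B {j}) + move A B (J - {j}) \<in> S"
        using less.prems(4) unfolding split[OF \<open>j \<in> J\<close> subset_refl] .
      then have "(x + move A B {j}) + move A B (K' - {j}) \<in> S"
        by (rule IH[OF that(3)]) (use that \<open>j \<in> J\<close> in auto)
      then show ?thesis unfolding split[OF that(1,2)] .
    qed
    obtain M where M: "M \<subseteq> J" "M \<noteq> {}" "M \<noteq> J" "x + move A B M \<in> S"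
      and compl: "even (card J) \<Longrightarrow> x + move A B (J - M) \<in> S"
      using proper_move_in_dmc_set[OF less.prems(1-4)] True by metis
    obtain j where j: "j \<in> M" using M by blast
    have sj: "x + move A B {j} \<in> S"
      using IH[OF less.prems(3) M(4), of "{j}"] M j by auto
    have singleton: "x + move A B {k} \<in> S" if k: "k \<in> J" for k
    proof (cases "card J = 2")
      case True
      then show ?thesis
        using IH[OF less.prems(3) M(4), of "{k}"] IH[OF less.prems(3) compl, of "{k}"] M k by auto
    next
      case False
      have "x + move A B {j, k} \<in> S" using from_singleton[OF _ _ sj, of "{j, k}"] M j k by auto
      moreover have "{j, k} \<subset> J"
      proof -
        have "card {j, k} \<le> 2" by (cases "j = k") auto
        then have "{j, k} \<noteq> J" using False True by auto
        then show ?thesis using M j k by auto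
      qed
      ultimately show ?thesis using IH[OF less.prems(3), of "{j, k}" "{k}"] by auto
    qed
    then show ?thesis using from_singleton True less.prems(5) by blast
  qed
qed

section \<open>The parallelogram inequality\<close>

text \<open>The marginal gain of an element grows when elements are added to the base set one by one;
  adding up marginal gains shows that joining \<open>K\<close> to \<open>J - K\<close> gains at least as much as joining it
  to the empty set.\<close>

lemma supermodular_from_local:
  fixes g :: "'a set \<Rightarrow> real"
  assumes fin: "finite J"
    and local: "\<And>I j k. I \<subseteq> J \<Longrightarrow> j \<in> J - I \<Longrightarrow> k \<in> J - I \<Longrightarrow> j \<noteq> k \<Longrightarrow>
      g (insert j I) + g (insert k I) \<le> g I + g (insert j (insert k I))"
    and K: "K \<subseteq> J"
  shows "g K + g (J - K) \<le> g {} + g J"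
proof -
  have single: "g (insert j I) - g I \<le> g (insert j (I \<union> M)) - g (I \<union> M)"
    if "finite M" "I \<union> M \<subseteq> J" "j \<in> J - (I \<union> M)" "I \<inter> M = {}" for I M j
    using that
  proof (induction M rule: finite_induct)
    case empty
    then show ?case by simp
  next
    case (insert k M)
    have "g (insert j (I \<union> M)) + g (insert k (I \<union> M)) \<le> g (I \<union> M) + g (insert j (insert k (I \<union> M)))"
      using insert by (intro local) auto
    then show ?case using insert by auto
  qed
  have "g K - g {} \<le> g (K \<union> M) - g M"
    if "finite K" "K \<union> M \<subseteq> J" "K \<inter> M = {}" for K M
    using that
  proof (induction K rule: finite_induct)
    case empty
    then show ?case by simp
  next
    case (insert k K)
    have "finite M" using insert fin finite_subset by blast
    then have "g (insert k K) - g K \<le> g (insert k (K \<union> M)) - g (K \<union> M)"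
      using insert by (intro single) auto
    then show ?case using insert by auto
  qed
  from this[of K "J - K"] K finite_subset[OF K fin] show ?thesis
    by (auto simp: Un_absorb1)
qed

text \<open>The difference \<open>d\<^sub>j + d\<^sub>k\<close> has entries \<open>\<plusminus>2\<close> exactly on \<open>A k\<close> and \<open>B j\<close>. On the other
  coordinates rounding decides: up favours \<open>A j\<close>, down favours \<open>B k\<close>. So the upper midpoint is the
  step \<open>d\<^sub>j\<close> and the lower one the step \<open>d\<^sub>k\<close>.\<close>

lemma parallelogram_unit:
  assumes lay: "layered A B {j, k}" and jk: "j < k" and loc: "locally_dmc f"
  shows "f (z + move A B {j}) + f (z + move A B {k}) \<le> f z + f (z + move A B {j, k})"
proof -
  let ?y = "z + move A B {j, k}"
  have A: "i \<in> A k \<Longrightarrow> i \<in> A j" and B: "i \<in> B j \<Longrightarrow> i \<in> B k"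
    and AB: "i \<in> A j \<Longrightarrow> i \<notin> B k" for i
    using layeredD(2-4)[OF lay, of j k i] jk by auto
  have two: "card {j, k} = 2" using jk by simp
  obtain i where "\<bar>move A B {j, k} $ i\<bar> = 2" using move_extreme[OF lay] two by auto
  then have "2 \<le> linf_norm (move A B {j, k})" by (intro linf_norm_ge2I[of _ i]) auto
  moreover have "linf_norm (move A B {j, k}) \<le> 2"
    using move_bound[OF lay] two by (simp add: linf_norm_le_iff)
  ultimately have "linf_norm (z - ?y) = 2" unfolding linf_norm_minus_commute[of z] by simp
  then have "f (mid_up z ?y) + f (mid_down z ?y) \<le> f z + f ?y"
    using loc by (auto simp: locally_dmc_def dmc_ineq_def)
  moreover have "mid_up z ?y = z + move A B {j}"
    unfolding vec_eq_iff
  proof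
    fix i
    show "mid_up z ?y $ i = (z + move A B {j}) $ i"
      using A[of i] B[of i] AB[of i] jk unfolding mid_up_nth move_def
      by (cases "i \<in> A j"; cases "i \<in> A k"; cases "i \<in> B j"; cases "i \<in> B k") simp_all
  qed
  moreover have "mid_down z ?y = z + move A B {k}"
    unfolding vec_eq_iff
  proof
    fix i
    show "mid_down z ?y $ i = (z + move A B {k}) $ i"
      using A[of i] B[of i] AB[of i] jk unfolding mid_down_nth move_def
      by (cases "i \<in> A j"; cases "i \<in> A k"; cases "i \<in> B j"; cases "i \<in> B k") simp_all
  qed
  ultimately show ?thesis by simp
qed

lemma parallelogram_inequality:
  assumes loc: "locally_dmc f" and ninf: "\<And>x. f x \<noteq> - \<infinity>"
    and lay: "layered A B J" and dom: "x \<in> eff_dom f" "x + move A B J \<in> eff_dom f"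
    and K: "K \<subseteq> J"
  shows "f (x + move A B K) + f (x + move A B (J - K)) \<le> f x + f (x + move A B J)"
proof -
  define g where "g I = real_of_ereal (f (x + move A B I))" for I
  have fin: "finite J" using layeredD(1)[OF lay] .
  have g: "f (x + move A B I) = ereal (g I)" if "I \<subseteq> J" for I
  proof -
    have "x + move A B I \<in> eff_dom f"
      by (rule move_in_dmc_set[OF _ lay dom that]) (use loc in \<open>simp add: locally_dmc_def\<close>)
    then show ?thesis using ninf[of "x + move A B I"]
      by (cases "f (x + move A B I)") (auto simp: g_def eff_dom_def)
  qed
  have ordered: "g (insert j I) + g (insert k I) \<le> g I + g (insert j (insert k I))"
    if I: "I \<subseteq> J" "j \<in> J - I" "k \<in> J - I" "j < k" for I j k
  proof -
    have finI: "finite I" by (rule finite_subset[OF I(1) fin])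
    have "layered A B {j, k}" by (rule layered_subset[OF lay]) (use I in auto)
    from parallelogram_unit[OF this \<open>j < k\<close> loc, of "x + move A B I"]
    have "f (x + move A B (insert j I)) + f (x + move A B (insert k I))
        \<le> f (x + move A B I) + f (x + move A B (insert j (insert k I)))"
      using I finI by (simp add: move_insert[of I] move_insert[of "insert k I"] move_insert[of "{k}"] algebra_simps)
    then show ?thesis using I g[of I] g[of "insert j I"] g[of "insert k I"] g[of "insert j (insert k I)"]
      by auto
  qed
  have "g K + g (J - K) \<le> g {} + g J"
  proof (rule supermodular_from_local[OF fin _ K])
    fix I j k assume "I \<subseteq> J" "j \<in> J - I" "k \<in> J - I" "j \<noteq> k"
    then show "g (insert j I) + g (insert k I) \<le> g I + g (insert j (insert k I))"
      using ordered[of I j k] ordered[of I k j] by (cases "j < k") (auto simp: insert_commute)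
  qed
  then show ?thesis using g[of K] g[of "J - K"] g[of "{}"] g[of J] K by auto
qed

text \<open>The case \<open>K = {1, m}\<close>. The first index contributes a step up in every coordinate where \<open>y\<close>
  exceeds \<open>x\<close>, and the last one a step down wherever \<open>x\<close> exceeds \<open>y\<close>. A single index
  does not serve both signs in general; taking two of them accounts for the radius 2.\<close>

lemma two_step_parallelogram:
  fixes f :: "int^'n \<Rightarrow> ereal"
  assumes loc: "locally_dmc f" and ninf: "\<And>x. f x \<noteq> - \<infinity>"
    and dom: "x \<in> eff_dom f" "y \<in> eff_dom f" and far: "linf_norm (y - x) \<ge> 3"
  obtains \<delta> where "f (x + \<delta>) + f (y - \<delta>) \<le> f x + f y"
    and "\<And>i. \<bar>\<delta> $ i\<bar> \<le> 2"
    and "\<And>i. x $ i < y $ i \<Longrightarrow> 1 \<le> \<delta> $ i \<and> \<delta> $ i \<le> y $ i - x $ i"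
    and "\<And>i. y $ i < x $ i \<Longrightarrow> 1 \<le> - \<delta> $ i \<and> - \<delta> $ i \<le> x $ i - y $ i"
    and "\<And>i. x $ i = y $ i \<Longrightarrow> \<delta> $ i = 0"
proof -
  define m where "m = linf_norm (y - x)"
  define A where "A j = {i. int j \<le> y $ i - x $ i}" for j
  define B where "B j = {i. int m + 1 - int j \<le> x $ i - y $ i}" for j
  have bound: "\<bar>y $ i - x $ i\<bar> \<le> int m" for i
    using linf_norm_le_iff[of "y - x" m] by (simp add: m_def)
  obtain i0 where i0: "\<bar>y $ i0 - x $ i0\<bar> = int m"
    using linf_norm_attained[of "y - x"] by (auto simp: m_def)
  have lay: "layered A B {1..m}"
    unfolding layered_def
  proof (intro conjI)
    show "(\<forall>j\<in>{1..m}. A j \<noteq> {}) \<or> (\<forall>j\<in>{1..m}. B j \<noteq> {})"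
    proof (cases "y $ i0 - x $ i0 \<ge> 0")
      case True
      then have "i0 \<in> A j" if "j \<in> {1..m}" for j using i0 that by (auto simp: A_def)
      then show ?thesis by blast
    next
      case False
      then have "i0 \<in> B j" if "j \<in> {1..m}" for j using i0 that by (auto simp: B_def)
      then show ?thesis by blast
    qed
  qed (auto simp: A_def B_def)
  have all: "x + move A B {1..m} = y"
    unfolding vec_eq_iff
  proof
    fix i
    have "{j\<in>{1..m}. i \<in> A j} = {1..nat (y $ i - x $ i)}"
      using bound[of i] by (auto simp: A_def)
    moreover have "{j\<in>{1..m}. i \<in> B j} = {m + 1 - nat (x $ i - y $ i)..m}"
      using bound[of i] by (auto simp: B_def)
    ultimately show "(x + move A B {1..m}) $ i = y $ i"
      using bound[of i] by (auto simp: move_nth)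
  qed
  define \<delta> where "\<delta> = move A B {1, m}"
  have m3: "m \<ge> 3" using far unfolding m_def .
  have \<delta>: "\<delta> $ i = of_bool (x $ i < y $ i) + of_bool (int m \<le> y $ i - x $ i)
      - of_bool (y $ i < x $ i) - of_bool (int m \<le> x $ i - y $ i)" for i
    using m3 by (auto simp: \<delta>_def move_def A_def B_def)
  have sub: "{1, m} \<subseteq> {1..m}" using m3 by auto
  have "f (x + \<delta>) + f (x + move A B ({1..m} - {1, m})) \<le> f x + f y"
    using parallelogram_inequality[OF loc ninf lay dom(1) _ sub] dom(2)
    unfolding all \<delta>_def by simp
  moreover have "x + move A B ({1..m} - {1, m}) = y - \<delta>"
    using move_Diff[OF _ sub, of A B] all by (simp add: \<delta>_def algebra_simps)
  ultimately have ineq: "f (x + \<delta>) + f (y - \<delta>) \<le> f x + f y" by (simp only:)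
  show thesis
  proof (rule that[OF ineq])
    fix i
    show "\<bar>\<delta> $ i\<bar> \<le> 2" using m3 by (simp add: \<delta> of_bool_def)
    show "1 \<le> \<delta> $ i \<and> \<delta> $ i \<le> y $ i - x $ i" if "x $ i < y $ i"
      using m3 that by (simp add: \<delta> of_bool_def)
    show "1 \<le> - \<delta> $ i \<and> - \<delta> $ i \<le> x $ i - y $ i" if "y $ i < x $ i"
      using m3 that by (simp add: \<delta> of_bool_def)
    show "\<delta> $ i = 0" if "x $ i = y $ i" using m3 that by (simp add: \<delta>)
  qed
qed

section \<open>Minimizers in growing boxes\<close>

lemma globally_imp_locally_dmc:
  assumes ninf: "\<And>x. f x \<noteq> - \<infinity>" and glob: "globally_dmc f"
  shows "locally_dmc f"
proof -
  have "dmc_set (eff_dom f)"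
    unfolding dmc_set_def
  proof (intro ballI impI)
    fix x y assume xy: "x \<in> eff_dom f" "y \<in> eff_dom f" "2 \<le> linf_norm (x - y)"
    then have "f (mid_up x y) + f (mid_down x y) \<le> f x + f y"
      using glob by (auto simp: globally_dmc_def dmc_ineq_def)
    also have "\<dots> < \<infinity>" using xy by (simp add: eff_dom_def)
    finally show "mid_up x y \<in> eff_dom f \<and> mid_down x y \<in> eff_dom f"
      using ninf[of "mid_up x y"] ninf[of "mid_down x y"] by (auto simp: eff_dom_def)
  qed
  then show ?thesis using glob by (auto simp: locally_dmc_def globally_dmc_def)
qed

lemma minimizes_on_iff: "minimizes_on f S x \<longleftrightarrow> x \<in> S \<and> (\<forall>y\<in>S. f x \<le> f y)"
  by (auto simp: minimizes_on_def is_arg_min_linorder)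

lemma finite_sbox: "finite (sbox k (x0 :: int^'n))"
proof -
  have "sbox k x0 \<subseteq> vec_lambda ` (\<Pi>\<^sub>E i\<in>UNIV. {x0 $ i - int k..x0 $ i + int k})"
  proof
    fix x assume x: "x \<in> sbox k x0"
    have "x $ i \<in> {x0 $ i - int k..x0 $ i + int k}" for i
      using x[unfolded sbox_iff, rule_format, of i] by auto
    then have "vec_nth x \<in> (\<Pi>\<^sub>E i\<in>UNIV. {x0 $ i - int k..x0 $ i + int k})" by auto
    then show "x \<in> vec_lambda ` (\<Pi>\<^sub>E i\<in>UNIV. {x0 $ i - int k..x0 $ i + int k})"
      by (metis image_eqI vec_nth_inverse)
  qed
  then show ?thesis by (rule finite_subset) (intro finite_imageI finite_PiE; simp)
qed

lemma ex_minimizes_on: "finite S \<Longrightarrow> S \<noteq> {} \<Longrightarrow> \<exists>x. minimizes_on f S x"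
  using ex_is_arg_min_if_finite[of S f] by (simp add: minimizes_on_def)

text \<open>It suffices to replace a far \<open>y\<close> with a finite value. The vector \<open>\<delta>\<close> exchanges \<open>x, y\<close> for
  \<open>x + \<delta>, y - \<delta>\<close>, which lie coordinatewise between them. Since \<open>y - \<delta>\<close> falls back into the
  smaller box, its value is at least \<open>f x\<close>.\<close>

lemma minimizer_of_next_box_nearby:
  assumes loc: "locally_dmc f" and ninf: "\<And>x. f x \<noteq> - \<infinity>"
    and x: "x \<in> eff_dom f" "minimizes_on f (sbox k x0) x" and y: "y \<in> sbox (Suc k) x0"
  shows "\<exists>z\<in>nbhd2 x \<inter> sbox (Suc k) x0. f z \<le> f y"
proof -
  have xk: "x \<in> sbox k x0" and min: "\<And>z. z \<in> sbox k x0 \<Longrightarrow> f x \<le> f z"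
    using x by (auto simp: minimizes_on_iff)
  have xs: "\<bar>x $ i - x0 $ i\<bar> \<le> int k" and ys: "\<bar>y $ i - x0 $ i\<bar> \<le> int k + 1" for i
    using xk[unfolded sbox_iff, rule_format, of i] y[unfolded sbox_iff, rule_format, of i] by auto
  consider "f y = \<infinity>" | "y \<in> nbhd2 x" | "y \<in> eff_dom f" "linf_norm (y - x) \<ge> 3"
    by (fastforce simp: eff_dom_def nbhd2_def)
  then show ?thesis
  proof cases
    case 1
    have "x \<in> nbhd2 x" by (simp add: nbhd2_iff)
    moreover have "x \<in> sbox (Suc k) x0" using xk by (auto simp: sbox_def)
    ultimately show ?thesis using 1 by (intro bexI[of _ x]) auto
  next
    case 2
    then show ?thesis using y by auto
  next
    case 3
    obtain \<delta> where \<delta>: "f (x + \<delta>) + f (y - \<delta>) \<le> f x + f y"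
      and two: "\<And>i. \<bar>\<delta> $ i\<bar> \<le> 2"
      and pos: "\<And>i. x $ i < y $ i \<Longrightarrow> 1 \<le> \<delta> $ i \<and> \<delta> $ i \<le> y $ i - x $ i"
      and neg: "\<And>i. y $ i < x $ i \<Longrightarrow> 1 \<le> - \<delta> $ i \<and> - \<delta> $ i \<le> x $ i - y $ i"
      and zero: "\<And>i. x $ i = y $ i \<Longrightarrow> \<delta> $ i = 0"
      using two_step_parallelogram[OF loc ninf x(1) 3] by metis
    have "\<bar>x $ i + \<delta> $ i - x0 $ i\<bar> \<le> int k + 1" "\<bar>y $ i - \<delta> $ i - x0 $ i\<bar> \<le> int k" for i
      using xs[of i] ys[of i] pos[of i] neg[of i] zero[of i] by linarith+
    then have "x + \<delta> \<in> sbox (Suc k) x0" and "y - \<delta> \<in> sbox k x0"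
      by (auto simp: sbox_iff add.commute)
    moreover have "x + \<delta> \<in> nbhd2 x" using two by (simp add: nbhd2_iff)
    moreover have "f (x + \<delta>) \<le> f y"
    proof -
      have "f (x + \<delta>) + f x \<le> f (x + \<delta>) + f (y - \<delta>)"
        using min[OF \<open>y - \<delta> \<in> sbox k x0\<close>] by (intro add_left_mono)
      also have "\<dots> \<le> f y + f x" using \<delta> by (simp add: add.commute)
      finally show ?thesis
        using x(1) ninf[of x] by (cases "f x") (auto simp: eff_dom_def ereal_add_le_add_iff2)
    qed
    ultimately show ?thesis by blast
  qed
qed

lemma nbhd2_minimizer_minimizes_box:
  assumes "locally_dmc f" "\<And>x. f x \<noteq> - \<infinity>" "x \<in> eff_dom f" "minimizes_on f (sbox k x0) x"
    and "minimizes_on f (nbhd2 x \<inter> sbox (Suc k) x0) y"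
  shows "minimizes_on f (sbox (Suc k) x0) y"
  using assms(5) minimizer_of_next_box_nearby[OF assms(1-4)]
  unfolding minimizes_on_iff by (meson IntD2 order_trans)

text \<open>An improving \<open>z\<close> may be taken in the 2-neighbourhood of \<open>x\<close>. It lies outside the box of
  radius \<open>k + 1\<close> and \<open>x\<close> inside the one of radius \<open>k\<close>, so their distance is exactly 2, where even local
  convexity applies. Averages of coordinates at distance at most \<open>k\<close> and \<open>k + 2\<close> from those of
  \<open>x0\<close>, rounded either way, are at distance at most \<open>k + 1\<close>.\<close>

lemma stationary_minimizes_larger_box:
  assumes loc: "locally_dmc f" and ninf: "\<And>x. f x \<noteq> - \<infinity>" and x: "x \<in> eff_dom f" "x \<in> sbox k x0"
    and min: "minimizes_on f (sbox (Suc k) x0) x"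
  shows "minimizes_on f (sbox (Suc (Suc k)) x0) x"
proof (rule ccontr)
  assume "\<not> ?thesis"
  moreover have "x \<in> sbox (Suc (Suc k)) x0" using x(2) by (simp add: sbox_def)
  ultimately obtain y where "y \<in> sbox (Suc (Suc k)) x0" "f y < f x"
    by (auto simp: minimizes_on_iff not_le)
  then obtain z where z: "z \<in> nbhd2 x" "z \<in> sbox (Suc (Suc k)) x0" and less: "f z < f x"
    using minimizer_of_next_box_nearby[OF loc ninf x(1) min] by (meson IntE order.strict_trans1)
  have minD: "\<And>u. u \<in> sbox (Suc k) x0 \<Longrightarrow> f x \<le> f u" using min by (simp add: minimizes_on_iff)
  have xs: "\<bar>x $ i - x0 $ i\<bar> \<le> int k" and zs: "\<bar>z $ i - x0 $ i\<bar> \<le> int k + 2" for i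
    using x(2)[unfolded sbox_iff, rule_format, of i] z(2)[unfolded sbox_iff, rule_format, of i] by auto
  have "\<not> linf_norm (z - x) \<le> 1"
  proof
    assume "linf_norm (z - x) \<le> 1"
    then have "\<bar>z $ i - x $ i\<bar> \<le> 1" for i using linf_norm_le_iff[of "z - x" 1] by simp
    then have "\<bar>z $ i - x0 $ i\<bar> \<le> int k + 1" for i using xs[of i] by (smt (verit))
    then have "z \<in> sbox (Suc k) x0" by (simp add: sbox_iff add.commute)
    then show False using minD less by (simp add: not_less[symmetric])
  qed
  then have "linf_norm (x - z) = 2" using z(1) by (simp add: nbhd2_def linf_norm_minus_commute[of x])
  then have ineq: "f (mid_up x z) + f (mid_down x z) \<le> f x + f z"
    using loc by (auto simp: locally_dmc_def dmc_ineq_def)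
  have "\<bar>mid_up x z $ i - x0 $ i\<bar> \<le> int k + 1" "\<bar>mid_down x z $ i - x0 $ i\<bar> \<le> int k + 1" for i
    using xs[of i] zs[of i] unfolding mid_up_nth mid_down_nth by linarith+
  then have "f x \<le> f (mid_up x z)" "f x \<le> f (mid_down x z)"
    by (auto intro!: minD simp: sbox_iff add.commute)
  then have "f x + f x \<le> f (mid_up x z) + f (mid_down x z)" by (rule add_mono)
  with ineq have "f x + f x \<le> f x + f z" by simp
  then show False using less x(1) ninf[of x] ninf[of z]
    by (cases "f x"; cases "f z") (auto simp: eff_dom_def)
qed

lemma stationary_is_global_minimizer:
  assumes loc: "locally_dmc f" and ninf: "\<And>x. f x \<noteq> - \<infinity>" and x: "x \<in> eff_dom f" "x \<in> sbox k x0"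
    and min: "minimizes_on f (sbox (Suc k) x0) x"
  shows "x \<in> argmin_set f"
proof -
  have box: "minimizes_on f (sbox (Suc (k + n)) x0) x" for n
  proof (induction n)
    case 0
    then show ?case using min by simp
  next
    case (Suc n)
    have "x \<in> sbox (k + n) x0" using x(2) by (simp add: sbox_def)
    then show ?case using stationary_minimizes_larger_box[OF loc ninf x(1) _ Suc] by simp
  qed
  have "f x \<le> f y" for y
    using box[of "linf_norm (y - x0)"] by (auto simp: minimizes_on_iff sbox_def)
  then show ?thesis by (simp add: argmin_set_def minimizes_on_iff)
qed

section \<open>The algorithm\<close>

(* T counts the passes through D1--D3. It is at most L; counting the minimization in D0 as the
   first iteration, the total Suc T is exactly L, except when L = 1, where D0 and one
   confirming pass are always executed (so T = 1). *)
theorem theorem6p2: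
  fixes f :: "int^'n \<Rightarrow> ereal" and x0 :: "int^'n" and L :: nat
  assumes "\<And>x. f x \<noteq> - \<infinity>"
    and "globally_dmc f \<or> locally_dmc f"
    and "argmin_set f \<noteq> {}"
    and "x0 \<in> eff_dom f - argmin_set f"
    and "L = min_dist f x0"
  shows "\<exists>T. T \<le> L \<and> (L \<ge> 2 \<longrightarrow> Suc T = L) \<and> sd_outputs_after f x0 T (argmin_set f)"
proof -
  note ninf = assms(1)
  have loc: "locally_dmc f" using assms(2) globally_imp_locally_dmc[of f, OF ninf] by blast
  have x0: "x0 \<in> eff_dom f" "x0 \<notin> argmin_set f" using assms(4) by auto
  have "\<exists>l. \<exists>x\<in>argmin_set f. l = linf_norm (x - x0)" using assms(3) by blast
  then have "\<exists>x\<in>argmin_set f. L = linf_norm (x - x0)"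
    unfolding assms(5) min_dist_def by (rule LeastI_ex)
  then obtain xs where xs: "xs \<in> argmin_set f" "L = linf_norm (xs - x0)" by blast
  have L_le: "L \<le> linf_norm (x - x0)" if "x \<in> argmin_set f" for x
    unfolding assms(5) min_dist_def using that by (intro Least_le) blast
  have "L \<noteq> 0"
  proof
    assume "L = 0"
    then have "xs = x0" using linf_norm_le_iff[of "xs - x0" 0] xs(2) by (simp add: vec_eq_iff)
    then show False using xs x0 by simp
  qed
  have box_argmin: "x \<in> argmin_set f \<longleftrightarrow> L \<le> k" if "minimizes_on f (sbox k x0) x" for x k
  proof
    assume "x \<in> argmin_set f"
    then show "L \<le> k" using L_le[of x] that by (auto simp: minimizes_on_iff sbox_def)
  next
    assume "L \<le> k"
    then have "f x \<le> f xs" using that xs by (auto simp: minimizes_on_iff sbox_def)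
    then show "x \<in> argmin_set f"
      using xs(1) order_trans by (fastforce simp: argmin_set_def minimizes_on_iff)
  qed
  have x0_box: "x0 \<in> sbox k x0" for k by (simp add: sbox_iff)
  have dom: "x \<in> eff_dom f" if "minimizes_on f (sbox k x0) x" for x k
    using that x0(1) x0_box[of k] by (auto simp: minimizes_on_iff eff_dom_def dest!: bspec)

  \<comment> \<open>The pass with counter \<open>k\<close> stops iff the minimum on the box of radius \<open>k - 1\<close> is global, that
    is, iff \<open>L \<le> k - 1\<close>. Since \<open>k\<close> starts at 3, the stopping pass has number \<open>L - 1\<close>, or 1 when \<open>L = 1\<close>.\<close>
  define T where "T = max 1 (L - 1)"
  define inv where "inv m t \<longleftrightarrow>
      (m < T \<and> (\<exists>z. t = Loop (3 + m) z \<and> minimizes_on f (sbox (2 + m) x0) z)) \<or>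
      (m = T \<and> (\<exists>z\<in>argmin_set f. t = Output z))" for m t
  have inv_start: "inv 0 s" if "sd_start f x0 s" for s
    using that by cases (auto simp: inv_def T_def)
  have inv_step: "inv (Suc m) t'" if i: "inv m t" and st: "sd_iter f x0 t t'" for m t t'
  proof -
    obtain z where t: "t = Loop (3 + m) z" and z: "minimizes_on f (sbox (2 + m) x0) z" and m: "m < T"
      using i st by (auto simp: inv_def elim: sd_iter.cases)
    have Suc: "3 + m = Suc (2 + m)" by simp
    from st show ?thesis
      unfolding t Suc
    proof cases
      case (D2 y)
      have "minimizes_on f (sbox (Suc (2 + m)) x0) y"
        using nbhd2_minimizer_minimizes_box[OF loc ninf dom[OF z] z] D2 by blast
      then have "minimizes_on f (sbox (Suc (2 + m)) x0) z"
        using D2 z by (auto simp: minimizes_on_iff sbox_def)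
      then have "z \<in> argmin_set f"
        using stationary_is_global_minimizer[OF loc ninf dom[OF z]] z by (auto simp: minimizes_on_iff)
      moreover from this have "Suc m = T" using box_argmin[OF z] m by (auto simp: T_def)
      ultimately show ?thesis using D2 by (auto simp: inv_def)
    next
      case (D3 y)
      have y: "minimizes_on f (sbox (Suc (2 + m)) x0) y"
        using nbhd2_minimizer_minimizes_box[OF loc ninf dom[OF z] z] D3 by blast
      then have "f y \<le> f z" using z by (auto simp: minimizes_on_iff sbox_def)
      then have "f y < f z" using D3 by auto
      then have "z \<notin> argmin_set f" by (auto simp: argmin_set_def minimizes_on_iff not_le[symmetric])
      then have "Suc m < T" using box_argmin[OF z] by (auto simp: T_def)
      then show ?thesis using D3 y by (auto simp: inv_def)
    qed
  qed
  have inv_run: "inv m t" if "sd_start f x0 s" "(sd_iter f x0 ^^ m) s t" for s m t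
    using that(2)
  proof (induction m arbitrary: t)
    case 0
    then show ?case using inv_start[OF that(1)] by simp
  next
    case (Suc m)
    then show ?case using inv_step by (auto elim!: relcomppE)
  qed
  have progress: "\<exists>t'. sd_iter f x0 t t'" if i: "inv m t" "m < T" for m t
  proof -
    obtain z where t: "t = Loop (3 + m) z" and z: "minimizes_on f (sbox (2 + m) x0) z"
      using i by (auto simp: inv_def)
    have "z \<in> nbhd2 z \<inter> sbox (3 + m) x0"
      using z by (auto simp: minimizes_on_iff nbhd2_iff sbox_def)
    then obtain y where y: "minimizes_on f (nbhd2 z \<inter> sbox (3 + m) x0) y"
      using ex_minimizes_on[of "nbhd2 z \<inter> sbox (3 + m) x0" f] finite_sbox by blast
    show ?thesis unfolding t using sd_iter.intros[OF y] by (cases "f y = f z") blast+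
  qed
  have "\<exists>s. sd_start f x0 s"
    using ex_minimizes_on[of "sbox 2 x0" f] finite_sbox x0_box[of 2] sd_start.D0[OF x0(1)] by blast
  moreover have "m \<le> T \<and> (m < T \<longrightarrow> (\<exists>t'. sd_iter f x0 t t')) \<and>
      (m = T \<longrightarrow> (\<exists>z\<in>argmin_set f. t = Output z))"
    if run: "sd_start f x0 s \<and> (sd_iter f x0 ^^ m) s t" for s m t
  proof -
    have i: "inv m t" using run inv_run by blast
    then have "m \<le> T" "m = T \<longrightarrow> (\<exists>z\<in>argmin_set f. t = Output z)" by (auto simp: inv_def)
    then show ?thesis using progress[OF i] by blast
  qed
  ultimately have "sd_outputs_after f x0 T (argmin_set f)"
    unfolding sd_outputs_after_def by blast
  then show ?thesis using \<open>L \<noteq> 0\<close> by (intro exI[of _ T]) (auto simp: T_def)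
qed

end
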